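(* Let $(V,\mathrm{dist})$ be a metric space, $P\subseteq V$ a set of $n$ points with smallest inter-point distance greater than $1$ and diameter $2^{m-1}$ for some $m\in\mathbb N$, and let $\Gamma\ge 1$. For $i\in[m]$ let $w_i:=2^{m-i}$ and let $\varphi_i:V\to U$ be a map into some set $U$ such that $\mathrm{diam}(\varphi_i^{-1}(z))\le \tau_i:=w_i/2$ for every $z\in\varphi_i(V)$. Run the labeling algorithm described in the context on $P,\Gamma,\varphi_1,\dots,\varphi_m$, and let $\mathcal T$ be the embedding tree corresponding to the output labels. Then for all $p,q\in P$, $$\mathrm{dist}_{\mathcal T}(p,q)\ge \mathrm{dist}(p,q)\qquad\text{and}\qquad \mathbb E[\mathrm{dist}_{\mathcal T}(p,q)]\le O(\Gamma\log\Gamma)\cdot\log n\cdot\mathrm{dist}(p,q).$$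
   Context: Notation: $[m]=\{1,\dots,m\}$; $B(p,r)=\{y\in V:\mathrm{dist}(p,y)\le r\}$; for $S\subseteq V$, $\mathrm{buks}_i(S):=\bigcup_{x\in S}\varphi_i^{-1}(\varphi_i(x))$ (the union of the buckets of $\varphi_i$ meeting $S$), $\mathrm{buks}_i^P(S):=\mathrm{buks}_i(S)\cap P$, and $\tilde B_i^P(p,r):=\mathrm{buks}_i^P(B(p,r))$. Labeling algorithm: sample $\beta\in[\tfrac14,\tfrac12]$ uniformly at random, and let $\pi:P\to[0,1]$ be a uniform random map (i.i.d. uniform values, independent of $\beta$). For $i\in[m]$ put $r_i:=\beta w_i/\Gamma$, and for each $p\in P$ output the label $\ell_p^{(i)}:=\min\{\pi(u):u\in\tilde B_i^P(p,r_i)\}$. The maps $\varphi_i$ are given (black-box access). The expectation is over the randomness of the algorithm. Embedding tree $\mathcal T$: its nodes are the prefixes $(\ell_p^{(1)},\dots,\ell_p^{(i)})$, $p\in P$, $0\le i\le m$ (the root being the empty prefix), each prefix of length $i\ge 1$ being joined to its prefix of length $i-1$ by an edge of length $w_i$; the point $p$ is mapped to the leaf $(\ell_p^{(1)},\dots,\ell_p^{(m)})$. Thus, if $\mathrm{lv}(p,q)$ denotes the smallest $i\in[m]$ with $\ell_p^{(i)}\ne\ell_q^{(i)}$, then $\mathrm{dist}_{\mathcal T}(p,q)=\sum_{i=\mathrm{lv}(p,q)}^m 2w_i$.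
   Formalization: The lower bound is proved almost surely (ties in π are null) and only for Γ≥2, since it fails with positive probability for 1≤Γ<2 (e.g. Γ=1, m=3); O(Γ log Γ) is read as C·Γ·max(1, log₂Γ), as log Γ vanishes at Γ=1. *)

theory Defs
  imports "HOL-Probability.Probability" "Graph_Theory.Graph_Theory"
begin

text \<open>A metric space is given by a carrier \<open>V\<close> and a distance function \<open>d\<close>
  (locale \<^locale>\<open>Metric_space\<close>). The diameter takes values in \<open>[0, \<infinity>]\<close>, so that an unbounded
  set has diameter \<open>\<infinity>\<close>; the empty set has diameter \<open>0\<close>.\<close>

definition diam :: "('v \<Rightarrow> 'v \<Rightarrow> real) \<Rightarrow> 'v set \<Rightarrow> ennreal" where
  "diam d S = (SUP (x, y) \<in> S \<times> S. ennreal (d x y))"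

definition wt :: "nat \<Rightarrow> nat \<Rightarrow> real" where
  "wt m i = 2 ^ (m - i)"

definition buks :: "'v set \<Rightarrow> ('v \<Rightarrow> 'u) \<Rightarrow> 'v set \<Rightarrow> 'v set" where
  "buks V f S = (\<Union>x\<in>S. {y \<in> V. f y = f x})"

definition bucket_ball ::
  "'v set \<Rightarrow> ('v \<Rightarrow> 'v \<Rightarrow> real) \<Rightarrow> 'v set \<Rightarrow> ('v \<Rightarrow> 'u) \<Rightarrow> 'v \<Rightarrow> real \<Rightarrow> 'v set" where
  "bucket_ball V d P f p r = buks V f (Metric_space.mcball V d p r) \<inter> P"

definition label ::
  "'v set \<Rightarrow> ('v \<Rightarrow> 'v \<Rightarrow> real) \<Rightarrow> 'v set \<Rightarrow> nat \<Rightarrow> real \<Rightarrow> (nat \<Rightarrow> 'v \<Rightarrow> 'u) \<Rightarrow>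
    real \<times> ('v \<Rightarrow> real) \<Rightarrow> nat \<Rightarrow> 'v \<Rightarrow> real" where
  "label V d P m \<Gamma> \<phi> = (\<lambda>(\<beta>, \<pi>) i p. Min (\<pi> ` bucket_ball V d P (\<phi> i) p (\<beta> * wt m i / \<Gamma>)))"

text \<open>The joint law of \<open>(\<beta>, \<pi>)\<close>.\<close>

definition random_seed :: "'v set \<Rightarrow> (real \<times> ('v \<Rightarrow> real)) measure" where
  "random_seed P = uniform_measure lborel {1/4..1/2} \<Otimes>\<^sub>M
                   (\<Pi>\<^sub>M u\<in>P. uniform_measure lborel {0..1})"

text \<open>The embedding tree of a labelling \<open>l\<close>, where \<open>l i p\<close> is the level-\<open>i\<close> label of \<open>p\<close>.
  Its nodes are lists of labels; points with the same prefix share a node. An undirected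
  edge is a pair of opposite arcs, and the edge between lengths \<open>i - 1\<close> and \<open>i\<close> has weight
  \<open>wt m i\<close>. Distances are shortest-path distances.\<close>

definition label_prefix :: "(nat \<Rightarrow> 'v \<Rightarrow> 'l) \<Rightarrow> nat \<Rightarrow> 'v \<Rightarrow> 'l list" where
  "label_prefix l i p = map (\<lambda>j. l j p) [1..<Suc i]"

definition emb_tree ::
  "(nat \<Rightarrow> 'v \<Rightarrow> 'l) \<Rightarrow> 'v set \<Rightarrow> nat \<Rightarrow> ('l list, 'l list \<times> 'l list) pre_digraph" where
  "emb_tree l P m =
    \<lparr> verts = {label_prefix l i p | i p. i \<le> m \<and> p \<in> P},
      arcs = (\<Union>p\<in>P. \<Union>i\<in>{1..m}.
        {(label_prefix l i p, label_prefix l (i - 1) p),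
         (label_prefix l (i - 1) p, label_prefix l i p)}),
      tail = fst, head = snd \<rparr>"

definition edge_weight :: "nat \<Rightarrow> 'l list \<times> 'l list \<Rightarrow> real" where
  "edge_weight m = (\<lambda>(x, y). wt m (max (length x) (length y)))"

definition tree_dist :: "(nat \<Rightarrow> 'v \<Rightarrow> 'l) \<Rightarrow> 'v set \<Rightarrow> nat \<Rightarrow> 'v \<Rightarrow> 'v \<Rightarrow> real" where
  "tree_dist l P m p q =
    real_of_ereal (wf_digraph.\<mu> (emb_tree l P m) (edge_weight m) (label_prefix l m p) (label_prefix l m q))"

lemma length_label_prefix [simp]: "length (label_prefix l i p) = i"
  by (simp add: label_prefix_def)

lemma label_prefix_Suc: "label_prefix l (Suc i) p = label_prefix l i p @ [l (Suc i) p]"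
  by (simp add: label_prefix_def)

lemma take_label_prefix: "k \<le> i \<Longrightarrow> take k (label_prefix l i p) = label_prefix l k p"
  by (intro nth_equalityI) (auto simp: label_prefix_def simp del: upt_Suc)

lemma label_prefix_eq_iff:
  "label_prefix l i p = label_prefix l i q \<longleftrightarrow> (\<forall>j\<in>{1..i}. l j p = l j q)"
  by (auto simp: label_prefix_def)

lemma emb_tree_sel [simp]: "tail (emb_tree l P m) = fst" "head (emb_tree l P m) = snd"
  by (simp_all add: emb_tree_def)

lemma label_prefix_in_verts: "p \<in> P \<Longrightarrow> i \<le> m \<Longrightarrow> label_prefix l i p \<in> verts (emb_tree l P m)"
  by (auto simp: emb_tree_def)

lemma label_prefix_in_arcs:
  assumes "p \<in> P" "Suc k \<le> m"
  shows "(label_prefix l (Suc k) p, label_prefix l k p) \<in> arcs (emb_tree l P m)"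
    "(label_prefix l k p, label_prefix l (Suc k) p) \<in> arcs (emb_tree l P m)"
  using assms by (auto simp: emb_tree_def intro!: bexI[of _ p] bexI[of _ "Suc k"])

lemma wf_emb_tree: "wf_digraph (emb_tree l P m)"
proof
  fix e assume "e \<in> arcs (emb_tree l P m)"
  then obtain p i where pi: "p \<in> P" "i \<in> {1..m}"
    and e: "e = (label_prefix l i p, label_prefix l (i - 1) p) \<or>
            e = (label_prefix l (i - 1) p, label_prefix l i p)"
    by (auto simp: emb_tree_def)
  have "label_prefix l i p \<in> verts (emb_tree l P m)"
    "label_prefix l (i - 1) p \<in> verts (emb_tree l P m)"
    using pi by (auto intro: label_prefix_in_verts)
  then show "tail (emb_tree l P m) e \<in> verts (emb_tree l P m)"
    "head (emb_tree l P m) e \<in> verts (emb_tree l P m)"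
    using e by auto
qed

text \<open>Closed form of the tree distance in terms of the first level at which labels differ.\<close>

lemma tree_dist_eq:
  assumes pq: "p \<in> P" "q \<in> P" and lv: "lv \<in> {1..m}" "l lv p \<noteq> l lv q"
    and least: "\<And>j. j \<in> {1..<lv} \<Longrightarrow> l j p = l j q"
  shows "tree_dist l P m p q = (\<Sum>i=lv..m. 2 * wt m i)"
proof -
  interpret wf_digraph "emb_tree l P m" by (rule wf_emb_tree)
  let ?G = "emb_tree l P m" and ?c = "edge_weight m"
  let ?S = "\<lambda>k. \<Sum>i=lv..k. wt m i"
  have up: "\<exists>w. awalk (label_prefix l k u) w (label_prefix l (lv - 1) u) \<and> awalk_cost ?c w = ?S k"
    if "u \<in> P" "lv - 1 \<le> k" "k \<le> m" for u k
    using that(2,3)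
  proof (induction k rule: dec_induct)
    case base
    then show ?case using that(1) lv(1)
      by (intro exI[of _ "[]"]) (auto simp: awalk_Nil_iff label_prefix_in_verts)
  next
    case (step k)
    then obtain w where w: "awalk (label_prefix l k u) w (label_prefix l (lv - 1) u)"
      "awalk_cost ?c w = ?S k" by auto
    let ?e = "(label_prefix l (Suc k) u, label_prefix l k u)"
    have "?e \<in> arcs ?G" using that(1) step by (auto intro: label_prefix_in_arcs)
    then have "awalk (label_prefix l (Suc k) u) (?e # w) (label_prefix l (lv - 1) u)"
      using w(1) by (auto simp: awalk_Cons_iff)
    then show ?case using w(2) step lv(1)
      by (intro exI[of _ "?e # w"]) (auto simp: edge_weight_def sum.nat_ivl_Suc')
  qed
  have down: "\<exists>w. awalk (label_prefix l (lv - 1) u) w (label_prefix l k u) \<and> awalk_cost ?c w = ?S k"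
    if "u \<in> P" "lv - 1 \<le> k" "k \<le> m" for u k
    using that(2,3)
  proof (induction k rule: dec_induct)
    case base
    then show ?case using that(1) lv(1)
      by (intro exI[of _ "[]"]) (auto simp: awalk_Nil_iff label_prefix_in_verts)
  next
    case (step k)
    then obtain w where w: "awalk (label_prefix l (lv - 1) u) w (label_prefix l k u)"
      "awalk_cost ?c w = ?S k" by auto
    let ?e = "(label_prefix l k u, label_prefix l (Suc k) u)"
    have e: "?e \<in> arcs ?G" using that(1) step by (auto intro: label_prefix_in_arcs)
    have "awalk (label_prefix l k u) [?e] (label_prefix l (Suc k) u)"
      using arc_implies_awalk[OF e] by simp
    then have "awalk (label_prefix l (lv - 1) u) (w @ [?e]) (label_prefix l (Suc k) u)"
      using w(1) by (rule awalk_appendI[rotated])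
    then show ?case using w(2) step lv(1)
      by (intro exI[of _ "w @ [?e]"]) (auto simp: edge_weight_def sum.nat_ivl_Suc')
  qed
  have eq: "label_prefix l (lv - 1) p = label_prefix l (lv - 1) q"
    using least by (auto simp: label_prefix_eq_iff)
  have ne: "label_prefix l lv p \<noteq> label_prefix l lv q"
    using lv by (auto simp: label_prefix_eq_iff)
  define F where "F x = (if take lv x = label_prefix l lv p then - 1 else 1 :: real) * ?S (length x)" for x
  have wt0: "wt m i \<ge> 0" for i by (simp add: wt_def)
  have lip: "F y - F x \<le> ?c (x, y)" if "(x, y) \<in> arcs ?G" for x y
  proof -
    obtain u i where ui: "u \<in> P" "i \<in> {1..m}"
      and e: "(x, y) = (label_prefix l i u, label_prefix l (i - 1) u) \<or>
              (x, y) = (label_prefix l (i - 1) u, label_prefix l i u)"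
      using \<open>(x, y) \<in> arcs ?G\<close> unfolding emb_tree_def by auto
    obtain k where k: "i = Suc k" using ui by (cases i) auto
    have "\<bar>F (label_prefix l (Suc k) u) - F (label_prefix l k u)\<bar> \<le> wt m (Suc k)"
    proof (cases "lv \<le> k")
      case True
      then show ?thesis using wt0[of "Suc k"] by (auto simp: F_def take_label_prefix)
    next
      case False
      then consider "lv = Suc k" | "Suc k < lv" by linarith
      then show ?thesis using wt0[of "Suc k"] by cases (auto simp: F_def)
    qed
    then show ?thesis using e k wt0[of i] by (auto simp: edge_weight_def)
  qed
  have lower: "F y - F x \<le> awalk_cost ?c w" if "awalk x w y" for x y w
    using that
  proof (induction w arbitrary: x)
    case Nil
    then show ?case by (auto simp: awalk_Nil_iff)
  next
    case (Cons e w)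
    obtain a b where e: "e = (a, b)" by (cases e)
    have "x = a" "awalk b w y" "(a, b) \<in> arcs ?G"
      using Cons.prems by (auto simp: e awalk_Cons_iff)
    with Cons.IH[of b] lip[of a b] show ?case by (simp add: e)
  qed
  have val: "F (label_prefix l m q) - F (label_prefix l m p) = 2 * ?S m"
    using lv ne by (auto simp: F_def take_label_prefix)
  obtain w1 w2 where w1: "awalk (label_prefix l m p) w1 (label_prefix l (lv - 1) p)" "awalk_cost ?c w1 = ?S m"
    and w2: "awalk (label_prefix l (lv - 1) q) w2 (label_prefix l m q)" "awalk_cost ?c w2 = ?S m"
  proof -
    have "lv - 1 \<le> m" using lv(1) by auto
    then show ?thesis using that up[OF pq(1), of m] down[OF pq(2), of m] by blast
  qed
  have w: "awalk (label_prefix l m p) (w1 @ w2) (label_prefix l m q)"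
    using awalk_appendI[OF w1(1)] w2(1) eq by auto
  have "\<mu> ?c (label_prefix l m p) (label_prefix l m q) = ereal (2 * ?S m)"
  proof (rule antisym)
    show "\<mu> ?c (label_prefix l m p) (label_prefix l m q) \<le> ereal (2 * ?S m)"
      using min_cost_le_walk_cost[OF w, of ?c] w1(2) w2(2) by simp
    show "ereal (2 * ?S m) \<le> \<mu> ?c (label_prefix l m p) (label_prefix l m q)"
      unfolding \<mu>_def using lower val by (intro INF_greatest) force
  qed
  then show ?thesis by (simp add: tree_dist_def sum_distrib_left)
qed

end

theory Submission
  imports Defs
begin

text \<open>Two points with equal level-\<open>i\<close> labels almost surely share a bucket, since \<open>\<pi>\<close> is injective,
  and are therefore at distance at most \<open>2 * r\<^sub>i + \<tau>\<^sub>i \<le> w\<^sub>i\<close> when \<open>\<Gamma> \<ge> 2\<close>. If the labels first differ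
  at level \<open>i + 1\<close>, the tree distance is \<open>4 * w\<^bsub>i+1\<^esub> - 2 \<ge> w\<^sub>i\<close>; this gives domination.

  For the expectation, condition on \<open>\<beta>\<close>. Since the minimiser of \<open>\<pi>\<close> over a finite set is uniform,
  the minima over \<open>S\<close> and \<open>T\<close> differ with probability at most \<open>1 - |S \<inter> T| / |S \<union> T|\<close>. With
  \<open>t = d p q * \<Gamma> / w\<^sub>i\<close>, the bucket balls of \<open>p\<close> at parameters \<open>\<beta> - t\<close> and \<open>\<beta> + t\<close> sandwich
  \<open>S \<inter> T\<close> and \<open>S \<union> T\<close>, so the probability is at most the increment over \<open>[\<beta> - t, \<beta> + t]\<close> of
  the logarithm of the size of the bucket ball. Averaging over \<open>\<beta>\<close> costs a factor \<open>O(t)\<close> and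
  leaves the logarithm of the ratio of the sizes of two metric balls whose radii differ by a
  factor \<open>O(\<Gamma>)\<close>. Summed over the levels this telescopes to \<open>O(log \<Gamma>) * ln n\<close>. Levels with
  \<open>t > 1/8\<close> have \<open>w\<^sub>i < 8 * \<Gamma> * d p q\<close>, so their total weight is a geometric series.\<close>

section \<open>Minimisers of independent atomless variables\<close>

text \<open>Of the uniform law on the unit interval, only independence, a common distribution and
  the absence of atoms matter for comparing minima.\<close>

locale iid_atomless = prob_space N for N :: "real measure" +
  fixes P :: "'v set"
  assumes finite_P: "finite P"
    and sets_N [measurable_cong]: "sets N = sets borel"
    and atomless: "emeasure N {x} = 0"
begin

abbreviation iid :: "('v \<Rightarrow> real) measure" where
  "iid \<equiv> \<Pi>\<^sub>M u\<in>P. N"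

lemma prob_space_iid: "prob_space iid"
  by (rule prob_space_PiM) (rule prob_space_axioms)

sublocale iid: prob_space iid
  by (rule prob_space_iid)

text \<open>Fubini with coordinate \<open>u\<close> integrated innermost: once the other coordinates
  are fixed, a tie confines it to the single point \<open>\<pi> v\<close>, which has measure
  zero.\<close>

lemma AE_coordinates_distinct:
  assumes "u \<in> P" "v \<in> P" "u \<noteq> v"
  shows "AE \<pi> in iid. \<pi> u \<noteq> \<pi> v"
proof -
  interpret product_sigma_finite "\<lambda>_::'v. N"
    by unfold_locales
  define I where "I = P - {u}"
  have I: "finite I" "u \<notin> I" "insert u I = P" "v \<in> I"
    using assms finite_P by (auto simp: I_def)
  define X where "X = {\<pi> \<in> space iid. \<pi> u = \<pi> v}"
  have X [measurable]: "X \<in> sets iid"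
    using assms unfolding X_def by measurable
  have "emeasure iid X = (\<integral>\<^sup>+ \<pi>. indicator X \<pi> \<partial>Pi\<^sub>M (insert u I) (\<lambda>_. N))"
    using I by simp
  also have "\<dots> = (\<integral>\<^sup>+ \<pi>. (\<integral>\<^sup>+ y. indicator X (\<pi>(u := y)) \<partial>N) \<partial>Pi\<^sub>M I (\<lambda>_. N))"
    using I by (intro product_nn_integral_insert) auto
  also have "\<dots> = (\<integral>\<^sup>+ \<pi>. 0 \<partial>Pi\<^sub>M I (\<lambda>_. N))"
  proof (intro nn_integral_cong)
    fix \<pi> assume "\<pi> \<in> space (Pi\<^sub>M I (\<lambda>_. N))"
    have "(\<integral>\<^sup>+ y. indicator X (\<pi>(u := y)) \<partial>N) \<le> (\<integral>\<^sup>+ y. indicator {\<pi> v} y \<partial>N)"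
      using assms by (intro nn_integral_mono) (auto simp: X_def indicator_def)
    also have "\<dots> = 0"
      using atomless by (subst nn_integral_indicator) (auto simp: sets_N)
    finally show "(\<integral>\<^sup>+ y. indicator X (\<pi>(u := y)) \<partial>N) = 0" by simp
  qed
  finally have "emeasure iid X = 0" by simp
  then show ?thesis
    using X by (intro AE_I[of _ _ X]) (auto simp: X_def)
qed

lemma AE_inj_on: "AE \<pi> in iid. inj_on \<pi> P"
proof -
  have "AE \<pi> in iid. \<forall>u\<in>P. \<forall>v\<in>P. u \<noteq> v \<longrightarrow> \<pi> u \<noteq> \<pi> v"
    using AE_coordinates_distinct finite_P by (intro AE_finite_allI) auto
  then show ?thesis
    by eventually_elim (auto simp: inj_on_def)
qed

text \<open>The strict inequality makes the events of different \<open>u\<close> disjoint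
  everywhere, not just almost surely.\<close>

definition argmin_at :: "'v set \<Rightarrow> 'v \<Rightarrow> ('v \<Rightarrow> real) set" where
  "argmin_at U u = {\<pi> \<in> space iid. \<forall>v\<in>U - {u}. \<pi> u < \<pi> v}"

lemma sets_argmin_at [measurable]:
  assumes "U \<subseteq> P" "u \<in> U"
  shows "argmin_at U u \<in> sets iid"
proof -
  have "finite (U - {u})"
    using assms finite_P finite_subset by auto
  moreover have "u \<in> P" "\<And>v. v \<in> U \<Longrightarrow> v \<in> P" using assms by auto
  ultimately show ?thesis
    unfolding argmin_at_def by measurable
qed

text \<open>Exchangeability: swapping the coordinates \<open>u\<close> and \<open>v\<close>
  preserves the product measure and carries one event to the other.\<close>

lemma prob_argmin_at_eq:
  assumes U: "U \<subseteq> P" "u \<in> U" "v \<in> U"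
  shows "iid.prob (argmin_at U u) = iid.prob (argmin_at U v)"
proof -
  define f where "f = Transposition.transpose u v"
  have f: "inj_on f P" "f \<in> P \<rightarrow> P"
    using U by (auto simp: f_def Transposition.transpose_def inj_on_def Pi_def split: if_splits)
  define t where "t = (\<lambda>\<pi> :: 'v \<Rightarrow> real. \<lambda>n\<in>P. \<pi> (f n))"
  have distr: "distr iid iid t = iid"
    unfolding t_def by (rule distr_PiM_reindex[OF prob_space_axioms f])
  have t [measurable]: "t \<in> iid \<rightarrow>\<^sub>M iid"
    using f unfolding t_def by (intro measurable_restrict measurable_component_singleton) auto
  have "iid.prob (argmin_at U u) = measure (distr iid iid t) (argmin_at U u)"
    by (simp add: distr)
  also have "\<dots> = iid.prob (t -` argmin_at U u \<inter> space iid)"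
    using U by (intro measure_distr) auto
  also have "t -` argmin_at U u \<inter> space iid = argmin_at U v"
  proof -
    have "(\<forall>w\<in>U - {u}. t \<pi> u < t \<pi> w) \<longleftrightarrow> (\<forall>w\<in>U - {v}. \<pi> v < \<pi> w)" for \<pi>
    proof -
      have img: "f ` (U - {u}) = U - {v}"
        using U by (auto simp: f_def Transposition.transpose_def image_iff split: if_splits)
      have "(\<forall>w\<in>U - {u}. t \<pi> u < t \<pi> w) \<longleftrightarrow> (\<forall>w\<in>U - {u}. \<pi> v < \<pi> (f w))"
        using U by (auto simp: t_def f_def)
      also have "\<dots> \<longleftrightarrow> (\<forall>w\<in>f ` (U - {u}). \<pi> v < \<pi> w)" by auto
      finally show ?thesis by (simp only: img)
    qed
    then show ?thesis
      using measurable_space[OF t] by (auto simp: argmin_at_def)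
  qed
  finally show ?thesis .
qed

text \<open>The \<open>card U\<close> events are disjoint and equally likely, so their common
  probability times \<open>card U\<close> is at most 1. An upper bound suffices, so no covering
  argument is made.\<close>

lemma prob_argmin_at_le:
  assumes "U \<subseteq> P" "u \<in> U"
  shows "iid.prob (argmin_at U u) \<le> 1 / card U"
proof -
  have fin: "finite U" using assms finite_P finite_subset by auto
  have "card U * iid.prob (argmin_at U u) = (\<Sum>v\<in>U. iid.prob (argmin_at U v))"
    using prob_argmin_at_eq[OF assms] by (simp flip: sum_constant cong: sum.cong)
  also have "\<dots> = iid.prob (\<Union>v\<in>U. argmin_at U v)"
  proof (rule iid.finite_measure_finite_Union[symmetric, OF fin])
    show "argmin_at U ` U \<subseteq> iid.events"
      using sets_argmin_at[OF assms(1)] by auto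
    show "disjoint_family_on (argmin_at U) U"
    proof (unfold disjoint_family_on_def, intro ballI impI)
      fix v w assume "v \<in> U" "w \<in> U" "v \<noteq> w"
      then have "\<pi> v < \<pi> w" "\<pi> w < \<pi> v" if "\<pi> \<in> argmin_at U v \<inter> argmin_at U w" for \<pi>
        using that by (auto simp: argmin_at_def)
      then show "argmin_at U v \<inter> argmin_at U w = {}"
        by (meson equals0I order.asym)
    qed
  qed
  also have "\<dots> \<le> 1" by simp
  finally have "real (card U) * iid.prob (argmin_at U u) \<le> 1" .
  moreover have "card U > 0" using fin assms by (auto simp: card_gt_0_iff)
  ultimately show ?thesis by (simp add: field_simps)
qed

text \<open>The min-hash bound with the Jaccard index. If the minimiser over the union lies in the
  intersection, both minima equal its value; a union bound covers the remaining points.\<close>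

theorem prob_Min_neq_le:
  assumes "S \<subseteq> P" "T \<subseteq> P" "S \<noteq> {}" "T \<noteq> {}"
  shows "iid.prob {\<pi> \<in> space iid. Min (\<pi> ` S) \<noteq> Min (\<pi> ` T)} \<le> 1 - card (S \<inter> T) / card (S \<union> T)"
proof -
  let ?U = "S \<union> T" and ?W = "S \<inter> T"
  have fin: "finite S" "finite T" "finite ?U" using assms finite_P finite_subset by auto
  have ne: "card ?U > 0" using assms fin by (auto simp: card_gt_0_iff)
  let ?E = "\<Union>u\<in>?U - ?W. argmin_at ?U u"
  have ev: "argmin_at ?U ` (?U - ?W) \<subseteq> iid.events"
    using sets_argmin_at[of ?U] assms by auto
  have "iid.prob {\<pi> \<in> space iid. Min (\<pi> ` S) \<noteq> Min (\<pi> ` T)} \<le> iid.prob ?E"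
  proof (rule iid.finite_measure_mono_AE)
    show "?E \<in> iid.events"
      using fin ev by (intro sets.finite_UN) auto
    \<comment> \<open>Only almost sure: when the minimum over the union is tied there is no strict
      minimiser, yet the two minima may differ.\<close>
    show "AE \<pi> in iid. \<pi> \<in> {\<pi> \<in> space iid. Min (\<pi> ` S) \<noteq> Min (\<pi> ` T)} \<longrightarrow> \<pi> \<in> ?E"
      using AE_inj_on
    proof eventually_elim
      fix \<pi> :: "'v \<Rightarrow> real" assume inj: "inj_on \<pi> P"
      show "\<pi> \<in> {\<pi> \<in> space iid. Min (\<pi> ` S) \<noteq> Min (\<pi> ` T)} \<longrightarrow> \<pi> \<in> ?E"
      proof
        assume \<pi>: "\<pi> \<in> {\<pi> \<in> space iid. Min (\<pi> ` S) \<noteq> Min (\<pi> ` T)}"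
        have "Min (\<pi> ` ?U) \<in> \<pi> ` ?U"
          using fin assms by (intro Min_in) auto
        then obtain u where u: "u \<in> ?U" "\<pi> u = Min (\<pi> ` ?U)" by (metis imageE)
        have le: "\<pi> u \<le> \<pi> v" if "v \<in> ?U" for v
          using u(2) that fin by simp
        have "\<pi> u \<noteq> \<pi> v" if "v \<in> ?U - {u}" for v
          using inj_onD[OF inj, of u v] u(1) that assms by auto
        then have "\<pi> \<in> argmin_at ?U u"
          using le \<pi> by (fastforce simp: argmin_at_def)
        moreover have "u \<notin> ?W"
        proof
          assume "u \<in> ?W"
          then have "Min (\<pi> ` S) = \<pi> u" "Min (\<pi> ` T) = \<pi> u"
            using le fin by (auto intro!: Min_eqI)
          then show False using \<pi> by auto
        qed
        ultimately show "\<pi> \<in> ?E" using u(1) by auto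
      qed
    qed
  qed
  also have "\<dots> \<le> (\<Sum>u\<in>?U - ?W. iid.prob (argmin_at ?U u))"
    using fin ev by (intro iid.finite_measure_subadditive_finite) auto
  also have "\<dots> \<le> (\<Sum>u\<in>?U - ?W. 1 / card ?U)"
    using assms by (intro sum_mono prob_argmin_at_le) auto
  also have "\<dots> = (real (card ?U) - card ?W) / card ?U"
  proof -
    have "card (?U - ?W) = card ?U - card ?W" "card ?W \<le> card ?U"
      using fin by (auto intro!: card_Diff_subset card_mono)
    then show ?thesis by (simp add: of_nat_diff)
  qed
  also have "\<dots> = 1 - card ?W / card ?U"
    using ne by (simp add: field_simps)
  finally show ?thesis .
qed

end

lemma prob_space_uniform_interval:
  assumes "a < b"
  shows "prob_space (uniform_measure lborel {a..b :: real})"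
  using assms by (intro prob_space_uniform_measure) auto

lemma iid_atomless_uniform:
  assumes "finite P"
  shows "iid_atomless (uniform_measure lborel {0..1 :: real}) P"
proof -
  interpret prob_space "uniform_measure lborel {0..1 :: real}"
    by (rule prob_space_uniform_interval) simp
  show ?thesis
  proof
    show "emeasure (uniform_measure lborel {0..1}) {x} = 0" for x :: real
      using emeasure_mono[of "{0..1} \<inter> {x}" "{x}" lborel] by (subst emeasure_uniform_measure) auto
  qed (use assms in auto)
qed

section \<open>Increments and telescoping sums\<close>

lemma integrable_indicator_mono:
  fixes g :: "real \<Rightarrow> real"
  assumes "mono g"
  shows "integrable lborel (\<lambda>x. indicator {a..b} x * g x)"
proof (rule Bochner_Integration.integrable_bound)
  show "integrable lborel (\<lambda>x. indicator {a..b} x * (\<bar>g a\<bar> + \<bar>g b\<bar>))"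
  proof -
    have "emeasure lborel {a..b} < \<infinity>" by (simp add: emeasure_lborel_Icc_eq)
    then show ?thesis
      by (intro integrable_mult_left) (auto simp: integrable_indicator_iff)
  qed
  show "(\<lambda>x. indicator {a..b} x * g x) \<in> borel_measurable lborel"
    using borel_measurable_mono[OF assms] by measurable
  show "AE x in lborel. norm (indicator {a..b} x * g x) \<le> norm (indicator {a..b} x * (\<bar>g a\<bar> + \<bar>g b\<bar>))"
  proof (intro AE_I2)
    fix x
    show "norm (indicator {a..b} x * g x) \<le> norm (indicator {a..b} x * (\<bar>g a\<bar> + \<bar>g b\<bar>))"
    proof (cases "x \<in> {a..b}")
      case True
      then have "g a \<le> g x" "g x \<le> g b" using assms by (auto dest: monoD)
      then show ?thesis using True by simp
    qed simp
  qed
qed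

text \<open>Shifting the variable turns the two terms into integrals of \<open>g\<close> over
  \<open>{a + t..b + t}\<close> and \<open>{a - t..b - t}\<close>. The overlap cancels, leaving
  windows of length at most \<open>2 * t\<close> at the two ends, where monotonicity bounds
  \<open>g\<close>.\<close>

lemma nn_integral_mono_increment_le:
  fixes g :: "real \<Rightarrow> real"
  assumes g: "mono g" and "a \<le> b" "0 \<le> t"
  shows "(\<integral>\<^sup>+ x. ennreal (g (x + t) - g (x - t)) * indicator {a..b} x \<partial>lborel)
    \<le> ennreal (2 * t * (g (b + t) - g (a - t)))"
proof -
  have shift: "integrable lborel (\<lambda>x. indicator {a..b} x * g (x + s))"
    "(\<integral>x. indicator {a..b} x * g (x + s) \<partial>lborel) = (\<integral>x. indicator {a + s..b + s} x * g x \<partial>lborel)" for s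
  proof -
    \<comment> \<open>The shape \<open>s + 1 * x\<close> fits the affine substitution rules with
      factor 1.\<close>
    have eq: "indicator {a..b} x * g (x + s) = indicator {a + s..b + s} (s + 1 * x) * g (s + 1 * x)" for x
      by (auto simp: indicator_def add.commute)
    show "integrable lborel (\<lambda>x. indicator {a..b} x * g (x + s))"
      unfolding eq by (rule lborel_integrable_real_affine[OF integrable_indicator_mono[OF g]]) simp
    show "(\<integral>x. indicator {a..b} x * g (x + s) \<partial>lborel) = (\<integral>x. indicator {a + s..b + s} x * g x \<partial>lborel)"
      unfolding eq using lborel_integral_real_affine[of 1 "\<lambda>x. indicator {a + s..b + s} x * g x" s] by simp
  qed
  have nonneg: "0 \<le> g (x + t) - g (x - t)" for x
    using monoD[OF g, of "x - t" "x + t"] \<open>0 \<le> t\<close> by simp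
  have ind: "integrable lborel (indicator {b - t<..b + t} :: real \<Rightarrow> real)"
    "integrable lborel (indicator {a - t..<a + t} :: real \<Rightarrow> real)"
    using \<open>0 \<le> t\<close> by (simp_all add: integrable_indicator_iff less_top[symmetric])
  have bd: "integrable lborel (\<lambda>x. g (b + t) * indicator {b - t<..b + t} x)"
    "integrable lborel (\<lambda>x. g (a - t) * indicator {a - t..<a + t} x)"
    by (rule integrable_mult_right, rule ind)+
  let ?I = "\<lambda>c d x. indicator {c..d} x * g x"
  have "(\<integral>x. indicator {a..b} x * g (x + t) - indicator {a..b} x * g (x + - t) \<partial>lborel)
    = (\<integral>x. ?I (a + t) (b + t) x - ?I (a + - t) (b + - t) x \<partial>lborel)"
    by (simp only: Bochner_Integration.integral_diff shift integrable_indicator_mono[OF g])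
  also have "\<dots> \<le> (\<integral>x. g (b + t) * indicator {b - t<..b + t} x - g (a - t) * indicator {a - t..<a + t} x \<partial>lborel)"
  proof (intro integral_mono Bochner_Integration.integrable_diff integrable_indicator_mono[OF g] bd)
    fix x
    \<comment> \<open>Needed when \<open>2 * t > b - a\<close>: between \<open>b - t\<close> and
      \<open>a + t\<close> the left side vanishes while both end windows are active.\<close>
    have "g (a - t) \<le> g (b + t)" using monoD[OF g, of "a - t" "b + t"] assms by simp
    moreover have "x \<le> b + t \<Longrightarrow> g x \<le> g (b + t)" "a - t \<le> x \<Longrightarrow> g (a - t) \<le> g x"
      using g by (auto dest: monoD)
    ultimately show "?I (a + t) (b + t) x - ?I (a + - t) (b + - t) x
        \<le> g (b + t) * indicator {b - t<..b + t} x - g (a - t) * indicator {a - t..<a + t} x"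
      using assms by (auto simp: indicator_def)
  qed
  also have "\<dots> = 2 * t * (g (b + t) - g (a - t))"
    using \<open>0 \<le> t\<close> by (subst Bochner_Integration.integral_diff[OF bd]) (simp_all add: algebra_simps)
  finally have le: "(\<integral>x. indicator {a..b} x * g (x + t) - indicator {a..b} x * g (x + - t) \<partial>lborel)
    \<le> 2 * t * (g (b + t) - g (a - t))" .
  have "(\<integral>\<^sup>+ x. ennreal (g (x + t) - g (x - t)) * indicator {a..b} x \<partial>lborel)
    = (\<integral>\<^sup>+ x. ennreal (indicator {a..b} x * g (x + t) - indicator {a..b} x * g (x + - t)) \<partial>lborel)"
    by (intro nn_integral_cong) (auto simp: indicator_def)
  also have "\<dots> = ennreal (\<integral>x. indicator {a..b} x * g (x + t) - indicator {a..b} x * g (x + - t) \<partial>lborel)"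
    using nonneg by (intro nn_integral_eq_integral Bochner_Integration.integrable_diff shift)
      (auto simp: indicator_def)
  also have "\<dots> \<le> ennreal (2 * t * (g (b + t) - g (a - t)))"
    using le by (rule ennreal_leI)
  finally show ?thesis .
qed

text \<open>Covers zero as well, because \<open>ln 0 = 0\<close>; empty balls therefore need no
  special treatment.\<close>

lemma ln_of_nat_mono: "a \<le> b \<Longrightarrow> ln (real a) \<le> ln (real b)"
  by (cases "a = 0"; cases "b = 0") auto

text \<open>Raising the shift by one adds a telescoping sum, worth at most the range
  \<open>B\<close> of \<open>F\<close>.\<close>

lemma sum_shift_diff_le:
  fixes F :: "nat \<Rightarrow> real"
  assumes "\<And>j. 0 \<le> F j" "\<And>j. F j \<le> B"
  shows "(\<Sum>j<m. F (j + k) - F j) \<le> real k * B"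
proof (induction k)
  case (Suc k)
  have "(\<Sum>j<m. F (j + Suc k) - F j) = (\<Sum>j<m. F (j + k) - F j) + (\<Sum>j<m. F (Suc j + k) - F (j + k))"
    by (simp flip: sum.distrib)
  also have "(\<Sum>j<m. F (Suc j + k) - F (j + k)) = F (m + k) - F k"
    using sum_lessThan_telescope[of "\<lambda>j. F (j + k)" m] by simp
  also have "\<dots> \<le> B" using assms[of k] assms[of "m + k"] by linarith
  finally show ?case using Suc by (simp add: algebra_simps)
qed simp

text \<open>A geometric series is less than twice its largest term, and that term is below
  \<open>x\<close>.\<close>

lemma sum_small_powers_le:
  fixes x :: real
  assumes "0 \<le> x"
  shows "(\<Sum>j<m. if 2 ^ j < x then 2 ^ j else 0) \<le> 2 * x"
proof (induction m)
  case (Suc m)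
  show ?case
  proof (cases "2 ^ m < x")
    case True
    have "(\<Sum>j<Suc m. if 2 ^ j < x then 2 ^ j else 0) \<le> (\<Sum>j<Suc m. 2 ^ j :: real)"
      by (intro sum_mono) auto
    also have "\<dots> = 2 * 2 ^ m - (1 :: real)"
      by (induction m) auto
    finally show ?thesis using True by linarith
  next
    case False
    then show ?thesis using Suc by simp
  qed
qed (use assms in simp)

lemma dist_le_diam: "x \<in> S \<Longrightarrow> y \<in> S \<Longrightarrow> ennreal (d x y) \<le> diam d S"
  unfolding diam_def by (rule SUP_upper2[of "(x, y)"]) auto

section \<open>Tree distance\<close>

lemma wt_pos: "0 < wt m i"
  by (simp add: wt_def)

lemma sum_wt:
  assumes "i \<le> m"
  shows "(\<Sum>j=i..m. 2 * wt m j) = 4 * wt m i - 2"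
  using assms
proof (induction rule: inc_induct)
  case base
  then show ?case by (simp add: wt_def)
next
  case (step i)
  have "wt m i = 2 * wt m (Suc i)"
    unfolding wt_def using Suc_diff_Suc[OF step(2)] by (metis power_Suc)
  then show ?case using step by (simp add: sum.atLeast_Suc_atMost[of i])
qed

text \<open>Complements \<open>tree_dist_eq\<close>, which presupposes a level where the labels
  differ. The empty walk is optimal because edge weights are nonnegative.\<close>

lemma tree_dist_0:
  assumes "p \<in> P" "\<And>i. i \<in> {1..m} \<Longrightarrow> l i p = l i q"
  shows "tree_dist l P m p q = 0"
proof -
  interpret wf_digraph "emb_tree l P m" by (rule wf_emb_tree)
  let ?x = "label_prefix l m p"
  have "awalk ?x [] ?x"
    using assms(1) by (auto simp: awalk_Nil_iff label_prefix_in_verts)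
  from min_cost_le_walk_cost[OF this, of "edge_weight m"]
  have "\<mu> (edge_weight m) ?x ?x \<le> 0" by (simp add: zero_ereal_def)
  moreover have "0 \<le> \<mu> (edge_weight m) ?x ?x"
    unfolding \<mu>_def
    by (intro INF_greatest) (auto intro!: pos_cost_pos_awalk_cost simp: edge_weight_def less_imp_le[OF wt_pos])
  moreover have "label_prefix l m q = ?x"
    using assms(2) by (simp add: label_prefix_eq_iff)
  ultimately show ?thesis by (simp add: tree_dist_def)
qed

text \<open>At most one summand is nonzero, the one at the first differing level. As a finite sum
  over events, the distance can be handled level by level for measurability and
  integrability.\<close>

lemma tree_dist_eq_sum:
  assumes "p \<in> P" "q \<in> P"
  shows "tree_dist l P m p q =
    (\<Sum>i=1..m. if l i p \<noteq> l i q \<and> (\<forall>j\<in>{1..<i}. l j p = l j q) then 4 * wt m i - 2 else 0)"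
proof (cases "\<exists>i\<in>{1..m}. l i p \<noteq> l i q")
  case True
  define k where "k = (LEAST i. i \<in> {1..m} \<and> l i p \<noteq> l i q)"
  have k: "k \<in> {1..m}" "l k p \<noteq> l k q"
    using True LeastI_ex[of "\<lambda>i. i \<in> {1..m} \<and> l i p \<noteq> l i q"] unfolding k_def by blast+
  have least: "l j p = l j q" if "j \<in> {1..<k}" for j
    using not_less_Least[of j "\<lambda>i. i \<in> {1..m} \<and> l i p \<noteq> l i q"] that k by (auto simp: k_def)
  have iff: "l i p \<noteq> l i q \<and> (\<forall>j\<in>{1..<i}. l j p = l j q) \<longleftrightarrow> i = k" if "i \<in> {1..m}" for i
    using that k least by (metis atLeastAtMost_iff atLeastLessThan_iff linorder_neqE_nat)
  have "tree_dist l P m p q = (\<Sum>i=k..m. 2 * wt m i)"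
    using tree_dist_eq[where l = l, OF assms k least] .
  also have "\<dots> = 4 * wt m k - 2"
    using k by (intro sum_wt) auto
  also have "\<dots> = (\<Sum>i=1..m. if i = k then 4 * wt m i - 2 else 0)"
    using k by simp
  also have "\<dots> = (\<Sum>i=1..m. if l i p \<noteq> l i q \<and> (\<forall>j\<in>{1..<i}. l j p = l j q) then 4 * wt m i - 2 else 0)"
    by (intro sum.cong refl) (simp only: iff)
  finally show ?thesis .
next
  case False
  then show ?thesis
    using tree_dist_0[of p P m l q] assms by (auto intro!: sum.neutral)
qed

text \<open>Forgetting that the level is the first one leaves events that involve one level each, so
  linearity of expectation applies.\<close>

lemma tree_dist_le:
  assumes "p \<in> P" "q \<in> P"
  shows "tree_dist l P m p q \<le> (\<Sum>i=1..m. if l i p \<noteq> l i q then 4 * wt m i else 0)"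
  unfolding tree_dist_eq_sum[OF assms]
  by (intro sum_mono) (auto simp: less_imp_le[OF wt_pos])

section \<open>Bucket balls and domination\<close>

locale bucketing = Metric_space V d
  for V :: "'v set" and d :: "'v \<Rightarrow> 'v \<Rightarrow> real" +
  fixes P :: "'v set" and m :: nat and \<Gamma> :: real and \<phi> :: "nat \<Rightarrow> 'v \<Rightarrow> 'u"
  assumes P_subset: "P \<subseteq> V"
    and finite_P: "finite P"
    and \<Gamma>_ge_1: "1 \<le> \<Gamma>"
    and bucket_dist: "\<lbrakk>i \<in> {1..m}; x \<in> V; y \<in> V; \<phi> i x = \<phi> i y\<rbrakk> \<Longrightarrow> d x y \<le> wt m i / 2"
begin

abbreviation bball :: "nat \<Rightarrow> 'v \<Rightarrow> real \<Rightarrow> 'v set" where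
  "bball i \<equiv> bucket_ball V d P (\<phi> i)"

abbreviation rad :: "nat \<Rightarrow> real \<Rightarrow> real" where
  "rad i \<beta> \<equiv> \<beta> * wt m i / \<Gamma>"

abbreviation lbl :: "real \<times> ('v \<Rightarrow> real) \<Rightarrow> nat \<Rightarrow> 'v \<Rightarrow> real" where
  "lbl \<equiv> label V d P m \<Gamma> \<phi>"

lemma mem_bball:
  "u \<in> bball i p r \<longleftrightarrow> u \<in> P \<and> p \<in> V \<and> (\<exists>x\<in>V. d p x \<le> r \<and> \<phi> i u = \<phi> i x)"
  using P_subset by (auto simp: bucket_ball_def buks_def)

lemma bball_subset_P: "bball i p r \<subseteq> P"
  by (auto simp: mem_bball)

lemma finite_bball: "finite (bball i p r)"
  using bball_subset_P finite_P by (rule finite_subset)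

lemma bball_mono: "r \<le> s \<Longrightarrow> bball i p r \<subseteq> bball i p s"
  by (force simp: mem_bball)

text \<open>Moving the centre enlarges only the metric ball; the buckets stay the same. This yields
  the sandwich around \<open>p\<close> for the bucket ball of \<open>q\<close>.\<close>

lemma bball_subset_bball:
  assumes "p \<in> V" "q \<in> V"
  shows "bball i p r \<subseteq> bball i q (r + d p q)"
proof
  fix u assume "u \<in> bball i p r"
  then obtain x where x: "u \<in> P" "x \<in> V" "d p x \<le> r" "\<phi> i u = \<phi> i x"
    by (auto simp: mem_bball)
  have "d q x \<le> r + d p q"
    using triangle[of q p x] commute[of p q] x assms by simp
  then show "u \<in> bball i q (r + d p q)" using x assms by (auto simp: mem_bball)
qed

lemma center_in_bball: "p \<in> P \<Longrightarrow> 0 \<le> r \<Longrightarrow> p \<in> bball i p r"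
  using P_subset by (force simp: mem_bball)

lemma mcball_subset_bball: "mcball p r \<inter> P \<subseteq> bball i p r"
  by (auto simp: mem_bball)

lemma bball_dist_le:
  assumes "i \<in> {1..m}" "u \<in> bball i p r"
  shows "d p u \<le> r + wt m i / 2"
proof -
  obtain x where x: "u \<in> V" "p \<in> V" "x \<in> V" "d p x \<le> r" "\<phi> i u = \<phi> i x"
    using assms(2) P_subset by (auto simp: mem_bball)
  then show ?thesis
    using triangle[of p x u] bucket_dist[of i x u] assms(1) by simp
qed

text \<open>The witnesses \<open>x\<close> and \<open>y\<close> both lie in the bucket of
  \<open>u\<close>, so the path from \<open>p\<close> through \<open>x\<close> and \<open>y\<close>
  to \<open>q\<close> crosses a single bucket.\<close>

lemma common_bucket_dist_le:
  assumes "i \<in> {1..m}" "u \<in> bball i p r" "u \<in> bball i q r"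
  shows "d p q \<le> 2 * r + wt m i / 2"
proof -
  obtain x y where x: "p \<in> V" "x \<in> V" "d p x \<le> r" "\<phi> i u = \<phi> i x"
    and y: "q \<in> V" "y \<in> V" "d q y \<le> r" "\<phi> i u = \<phi> i y"
    using assms(2,3) by (auto simp: mem_bball)
  have "d p q \<le> d p x + d x y + d y q"
    using triangle[of p x q] triangle[of x y q] x y by simp
  also have "d x y \<le> wt m i / 2"
    using bucket_dist[of i x y] assms(1) x y by simp
  finally show ?thesis using x y commute[of y q] by simp
qed

lemma lbl_eq: "lbl (\<beta>, \<pi>) i p = Min (\<pi> ` bball i p (rad i \<beta>))"
  by (simp add: label_def)

lemma rad_mono: "\<beta> \<le> \<beta>' \<Longrightarrow> rad i \<beta> \<le> rad i \<beta>'"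
  using \<Gamma>_ge_1 wt_pos[of m i] by (intro divide_right_mono mult_right_mono) auto

lemma rad_nonneg: "0 \<le> \<beta> \<Longrightarrow> 0 \<le> rad i \<beta>"
  using rad_mono[of 0 \<beta>] by simp

text \<open>Each label is attained in its bucket ball, which contains its centre; injectivity of
  \<open>\<pi>\<close> identifies the two minimisers.\<close>

lemma common_point_of_eq_lbl:
  assumes "inj_on \<pi> P" "0 \<le> \<beta>" "p \<in> P" "q \<in> P" "lbl (\<beta>, \<pi>) i p = lbl (\<beta>, \<pi>) i q"
  obtains u where "u \<in> bball i p (rad i \<beta>)" "u \<in> bball i q (rad i \<beta>)"
proof -
  have mem: "lbl (\<beta>, \<pi>) i x \<in> \<pi> ` bball i x (rad i \<beta>)" if "x \<in> P" for x
  proof -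
    have "x \<in> bball i x (rad i \<beta>)"
      using that \<open>0 \<le> \<beta>\<close> by (intro center_in_bball rad_nonneg)
    then show ?thesis
      unfolding lbl_eq using finite_bball by (intro Min_in) auto
  qed
  from mem[OF \<open>p \<in> P\<close>] obtain u where u: "u \<in> bball i p (rad i \<beta>)" "lbl (\<beta>, \<pi>) i p = \<pi> u"
    by (rule imageE) blast
  from mem[OF \<open>q \<in> P\<close>] obtain v where v: "v \<in> bball i q (rad i \<beta>)" "lbl (\<beta>, \<pi>) i q = \<pi> v"
    by (rule imageE) blast
  have "u = v"
    using u v assms(5) bball_subset_P by (intro inj_onD[OF assms(1)]) auto
  with u v show thesis by (intro that) auto
qed

theorem tree_dist_dominates:
  assumes sep: "\<And>p q. p \<in> P \<Longrightarrow> q \<in> P \<Longrightarrow> p \<noteq> q \<Longrightarrow> 1 < d p q"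
    and diam: "\<And>p q. p \<in> P \<Longrightarrow> q \<in> P \<Longrightarrow> d p q \<le> 2 ^ (m - 1)"
    and "1 \<le> m" "2 \<le> \<Gamma>" "inj_on \<pi> P" "\<beta> \<in> {1/4..1/2}" "p \<in> P" "q \<in> P"
  shows "d p q \<le> tree_dist (lbl (\<beta>, \<pi>)) P m p q"
proof (cases "p = q")
  case True
  then show ?thesis
    using tree_dist_0[of p P m "lbl (\<beta>, \<pi>)" q] assms P_subset by auto
next
  case False
  \<comment> \<open>Here \<open>2 \<le> \<Gamma>\<close> enters, with \<open>\<beta>\<close> at most
    1/2. It makes \<open>2 * r + w / 2\<close> at most \<open>w\<close>, and on level
    \<open>m\<close> it makes \<open>r + 1/2\<close> at most 3/4.\<close>
  have rad: "rad i \<beta> \<le> wt m i / 4" for i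
  proof -
    have "rad i \<beta> \<le> rad i (1/2)" using assms by (intro rad_mono) auto
    also have "\<dots> \<le> (1/2 * wt m i) / 2"
      using \<open>2 \<le> \<Gamma>\<close> wt_pos[of m i] by (intro divide_left_mono) auto
    finally show ?thesis by simp
  qed
  have common: "\<exists>u. u \<in> bball i p (rad i \<beta>) \<and> u \<in> bball i q (rad i \<beta>)"
    if "lbl (\<beta>, \<pi>) i p = lbl (\<beta>, \<pi>) i q" for i
  proof -
    have "0 \<le> \<beta>" using assms by auto
    show ?thesis
      by (rule common_point_of_eq_lbl[of \<pi> \<beta> p q i]) (use that assms \<open>0 \<le> \<beta>\<close> in blast)+
  qed
  \<comment> \<open>At level \<open>m\<close> a common point is closer than \<open>1\<close> to both \<open>p\<close> and \<open>q\<close>, hence equal to both.\<close>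
  have last: "lbl (\<beta>, \<pi>) m p \<noteq> lbl (\<beta>, \<pi>) m q"
  proof
    assume "lbl (\<beta>, \<pi>) m p = lbl (\<beta>, \<pi>) m q"
    then obtain u where u: "u \<in> bball m p (rad m \<beta>)" "u \<in> bball m q (rad m \<beta>)"
      using common by blast
    have "m \<in> {1..m}" "wt m m = 1" using \<open>1 \<le> m\<close> by (auto simp: wt_def)
    then have "d x u < 1" if "u \<in> bball m x (rad m \<beta>)" for x
      using order.trans[OF bball_dist_le[OF _ that] add_right_mono[OF rad]] by simp
    then have "d p u < 1" "d q u < 1" "u \<in> P"
      using u bball_subset_P by blast+
    then show False
      using sep[of p u] sep[of q u] assms(7,8) False by force
  qed
  define k where "k = (LEAST i. i \<in> {1..m} \<and> lbl (\<beta>, \<pi>) i p \<noteq> lbl (\<beta>, \<pi>) i q)"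
  have "m \<in> {1..m} \<and> lbl (\<beta>, \<pi>) m p \<noteq> lbl (\<beta>, \<pi>) m q" using last \<open>1 \<le> m\<close> by auto
  then have k: "k \<in> {1..m}" "lbl (\<beta>, \<pi>) k p \<noteq> lbl (\<beta>, \<pi>) k q"
    unfolding k_def by (rule LeastI2, blast)+
  have least: "lbl (\<beta>, \<pi>) j p = lbl (\<beta>, \<pi>) j q" if "j \<in> {1..<k}" for j
    using not_less_Least[of j "\<lambda>i. i \<in> {1..m} \<and> lbl (\<beta>, \<pi>) i p \<noteq> lbl (\<beta>, \<pi>) i q"] that k
    by (auto simp: k_def)
  have "tree_dist (lbl (\<beta>, \<pi>)) P m p q = (\<Sum>i=k..m. 2 * wt m i)"
    using tree_dist_eq[where l = "lbl (\<beta>, \<pi>)", OF assms(7,8) k least] .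
  also have "\<dots> = 4 * wt m k - 2"
    using k by (intro sum_wt) auto
  finally have td: "tree_dist (lbl (\<beta>, \<pi>)) P m p q = 4 * wt m k - 2" .
  \<comment> \<open>This absorbs the \<open>- 2\<close>: both \<open>w\<close> and
    \<open>2 * w\<close> are at most \<open>4 * w - 2\<close>.\<close>
  have wt1: "1 \<le> wt m k" by (simp add: wt_def)
  show ?thesis
  proof (cases "k = 1")
    \<comment> \<open>There is no earlier level to exploit; the diameter bound equals
      \<open>wt m 1\<close> and takes its place.\<close>
    case True
    then have "d p q \<le> wt m k" using diam[of p q] assms(7,8) by (simp add: wt_def)
    then show ?thesis using td wt1 by linarith
  next
    case False
    then have k': "k - 1 \<in> {1..m}" "k - 1 \<in> {1..<k}" "m - (k - 1) = Suc (m - k)" using k by auto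
    then obtain u where "u \<in> bball (k - 1) p (rad (k - 1) \<beta>)" "u \<in> bball (k - 1) q (rad (k - 1) \<beta>)"
      using common[OF least] by blast
    then have "d p q \<le> 2 * rad (k - 1) \<beta> + wt m (k - 1) / 2"
      using k' by (intro common_bucket_dist_le) auto
    also have "\<dots> \<le> wt m (k - 1)" using rad[of "k - 1"] by linarith
    also have "\<dots> = 2 * wt m k" using k' by (simp add: wt_def)
    finally show ?thesis using td wt1 by simp
  qed
qed

section \<open>Expected tree distance\<close>

sublocale \<pi>: iid_atomless "uniform_measure lborel {0..1}" P
  by (rule iid_atomless_uniform) (rule finite_P)

sublocale \<beta>: prob_space "uniform_measure lborel {1/4..1/2 :: real}"
  by (rule prob_space_uniform_interval) simp

sublocale seed: pair_prob_space "uniform_measure lborel {1/4..1/2 :: real}" \<pi>.iid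
  by unfold_locales

section \<open>Measurability in the random seed\<close>

lemma random_seed_eq: "random_seed P = uniform_measure lborel {1/4..1/2} \<Otimes>\<^sub>M \<pi>.iid"
  by (simp add: random_seed_def)

text \<open>Membership of a fixed point is monotone in \<open>\<beta>\<close>, hence Borel, and a
  subset of the finite \<open>P\<close> is determined by finitely many memberships.\<close>

lemma measurable_bball [measurable]:
  "(\<lambda>\<beta>. bball i p (rad i \<beta>)) \<in> borel \<rightarrow>\<^sub>M count_space (Pow P)"
proof -
  have mem: "{\<beta> \<in> space borel. u \<in> bball i p (rad i \<beta>)} \<in> sets borel" for u
  proof -
    have "mono (\<lambda>\<beta>. indicator (bball i p (rad i \<beta>)) u :: real)"
    proof (rule monoI)
      fix \<beta> \<beta>' :: real assume "\<beta> \<le> \<beta>'"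
      then show "indicator (bball i p (rad i \<beta>)) u \<le> (indicator (bball i p (rad i \<beta>')) u :: real)"
        using bball_mono[OF rad_mono, of \<beta> \<beta>' i p i] by (auto simp: indicator_def)
    qed
    from borel_measurable_mono[OF this]
    have "{\<beta> \<in> space borel. (indicator (bball i p (rad i \<beta>)) u :: real) = 1} \<in> sets borel"
      by (intro borel_measurable_eq) auto
    then show ?thesis by (simp add: indicator_eq_1_iff)
  qed
  have "(\<lambda>\<beta>. bball i p (rad i \<beta>)) -` {S} \<inter> space borel
      = {\<beta> \<in> space borel. \<forall>u\<in>P. u \<in> bball i p (rad i \<beta>) \<longleftrightarrow> u \<in> S}" if "S \<subseteq> P" for S
  proof -
    have "A = S \<longleftrightarrow> (\<forall>u\<in>P. u \<in> A \<longleftrightarrow> u \<in> S)" if "A \<subseteq> P" for A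
      using that \<open>S \<subseteq> P\<close> by blast
    from this[OF bball_subset_P] show ?thesis by auto
  qed
  moreover have "{\<beta> \<in> space borel. \<forall>u\<in>P. u \<in> bball i p (rad i \<beta>) \<longleftrightarrow> u \<in> S} \<in> sets borel" for S
  proof (rule sets.sets_Collect_finite_All[OF _ finite_P])
    show "{\<beta> \<in> space borel. u \<in> bball i p (rad i \<beta>) \<longleftrightarrow> u \<in> S} \<in> sets borel" for u
      using mem[of u] sets.sets_Collect_neg[OF mem[of u]] by (cases "u \<in> S") simp_all
  qed
  ultimately show ?thesis
    using finite_P bball_subset_P by (subst measurable_count_space_eq2) auto
qed

text \<open>The index set of the minimum depends on \<open>\<beta>\<close>. It takes finitely many
  values, and for each fixed value the minimum of coordinates is measurable.\<close>

lemma measurable_lbl [measurable]: "(\<lambda>\<omega>. lbl \<omega> i p) \<in> borel_measurable (random_seed P)"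
proof -
  let ?f = "\<lambda>S (\<omega> :: real \<times> ('v \<Rightarrow> real)). Min ((\<lambda>u. snd \<omega> u) ` S)"
  let ?g = "\<lambda>\<omega> :: real \<times> ('v \<Rightarrow> real). bball i p (rad i (fst \<omega>))"
  have f: "?f S \<in> borel_measurable (random_seed P)" if "S \<in> Pow P" for S
  proof (rule borel_measurable_Min)
    show "finite S" using that finite_P finite_subset by auto
    fix u assume "u \<in> S"
    with that have "u \<in> P" by auto
    then show "(\<lambda>\<omega>. snd \<omega> u) \<in> borel_measurable (random_seed P)"
      unfolding random_seed_def
      using measurable_compose[OF measurable_snd measurable_component_singleton[of u P "\<lambda>_. uniform_measure lborel {0..1 :: real}"],
        of "uniform_measure lborel {1/4..1/2 :: real}"] by simp
  qed
  have g: "?g \<in> random_seed P \<rightarrow>\<^sub>M count_space (Pow P)"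
  proof -
    have "fst \<in> borel_measurable (random_seed P)"
      unfolding random_seed_def
      using measurable_fst[of "uniform_measure lborel {1/4..1/2 :: real}" "\<pi>.iid"] by simp
    from measurable_compose[OF this measurable_bball] show ?thesis .
  qed
  have "countable (Pow P)" using finite_P by (intro countable_finite) simp
  from measurable_compose_countable'[of "Pow P" ?f, OF f g this]
  have "(\<lambda>\<omega>. ?f (?g \<omega>) \<omega>) \<in> borel_measurable (random_seed P)" .
  moreover have "(\<lambda>\<omega>. lbl \<omega> i p) = (\<lambda>\<omega>. ?f (?g \<omega>) \<omega>)"
    by (rule ext) (metis lbl_eq prod.collapse)
  ultimately show ?thesis by simp
qed

lemma measurable_tree_dist [measurable]:
  assumes "p \<in> P" "q \<in> P"
  shows "(\<lambda>\<omega>. tree_dist (lbl \<omega>) P m p q) \<in> borel_measurable (random_seed P)"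
proof -
  have "{\<omega> \<in> space (random_seed P). lbl \<omega> i p \<noteq> lbl \<omega> i q \<and> (\<forall>j\<in>{1..<i}. lbl \<omega> j p = lbl \<omega> j q)}
      \<in> sets (random_seed P)" for i
    by (intro sets.sets_Collect_conj sets.sets_Collect_finite_All borel_measurable_eq borel_measurable_neq
        measurable_lbl) auto
  then show ?thesis
    unfolding tree_dist_eq_sum[OF assms]
    by (intro borel_measurable_sum measurable_If measurable_const) auto
qed

lemma AE_random_seed:
  "AE \<omega> in random_seed P. fst \<omega> \<in> {1/4..1/2 :: real} \<and> inj_on (snd \<omega>) P"
  unfolding random_seed_eq
proof (rule seed.AE_pair_measure)
  show "{\<omega> \<in> space (uniform_measure lborel {1/4..1/2 :: real} \<Otimes>\<^sub>M \<pi>.iid). fst \<omega> \<in> {1/4..1/2 :: real} \<and> inj_on (snd \<omega>) P}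
      \<in> sets (uniform_measure lborel {1/4..1/2 :: real} \<Otimes>\<^sub>M \<pi>.iid)"
    unfolding inj_on_def using finite_P by measurable
  have "AE \<beta> in uniform_measure lborel {1/4..1/2 :: real}. \<beta> \<in> {1/4..1/2 :: real}"
    by (intro AE_uniform_measureI) auto
  then show "AE \<beta> in uniform_measure lborel {1/4..1/2 :: real}. AE \<pi> in \<pi>.iid.
      fst (\<beta>, \<pi>) \<in> {1/4..1/2 :: real} \<and> inj_on (snd (\<beta>, \<pi>)) P"
  proof eventually_elim
    fix \<beta> :: real assume "\<beta> \<in> {1/4..1/2 :: real}"
    then show "AE \<pi> in \<pi>.iid. fst (\<beta>, \<pi>) \<in> {1/4..1/2 :: real} \<and> inj_on (snd (\<beta>, \<pi>)) P"
      using \<pi>.AE_inj_on by simp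
  qed
qed

section \<open>Logarithmic growth of balls and the cost of one level\<close>

definition ln_bball :: "nat \<Rightarrow> 'v \<Rightarrow> real \<Rightarrow> real" where
  "ln_bball i p \<beta> = ln (card (bball i p (rad i \<beta>)))"

text \<open>Unlike \<open>ln_bball\<close>, this does not depend on the level, which is what lets
  the sum over levels telescope.\<close>

definition ln_ball :: "'v \<Rightarrow> real \<Rightarrow> real" where
  "ln_ball p r = ln (card (mcball p r \<inter> P))"

lemma mono_ln_bball: "mono (ln_bball i p)"
  unfolding ln_bball_def
  by (intro monoI ln_of_nat_mono card_mono finite_bball bball_mono rad_mono)

lemma mono_ln_ball: "mono (ln_ball p)"
  unfolding ln_ball_def using finite_P
  by (intro monoI ln_of_nat_mono card_mono Int_mono mcball_subset_concentric) auto

lemma ln_ball_bounds: "0 \<le> ln_ball p r" "ln_ball p r \<le> ln (card P)"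
  using ln_of_nat_mono[of 0 "card (mcball p r \<inter> P)"] finite_P
  by (auto simp: ln_ball_def intro!: ln_of_nat_mono card_mono)

text \<open>Changing \<open>\<beta>\<close> by \<open>t\<close> changes the level-\<open>i\<close>
  radius by exactly \<open>d p q\<close>, so the Jaccard index is at least the ratio of two bucket
  ball sizes around \<open>p\<close> alone.\<close>

lemma prob_lbl_neq_given_le:
  assumes "p \<in> P" "q \<in> P" and t: "t = d p q * \<Gamma> / wt m i" "t \<le> \<beta>"
  shows "\<pi>.iid.prob {\<pi> \<in> space \<pi>.iid. lbl (\<beta>, \<pi>) i p \<noteq> lbl (\<beta>, \<pi>) i q}
    \<le> ln_bball i p (\<beta> + t) - ln_bball i p (\<beta> - t)"
proof -
  let ?S = "bball i p (rad i \<beta>)" and ?T = "bball i q (rad i \<beta>)"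
  let ?W = "bball i p (rad i (\<beta> - t))" and ?U = "bball i p (rad i (\<beta> + t))"
  have V: "p \<in> V" "q \<in> V" using assms P_subset by auto
  have "t * wt m i / \<Gamma> = d p q"
    using t wt_pos[of m i] \<Gamma>_ge_1 by (simp add: field_simps)
  then have rad: "rad i (\<beta> - t) = rad i \<beta> - d p q" "rad i (\<beta> + t) = rad i \<beta> + d p q"
    by (simp_all add: algebra_simps add_divide_distrib diff_divide_distrib)
  have "0 \<le> t" using t wt_pos[of m i] \<Gamma>_ge_1 by simp
  have W: "?W \<subseteq> ?S \<inter> ?T"
    using bball_subset_bball[OF V, of i "rad i (\<beta> - t)"] bball_mono[OF rad_mono, of "\<beta> - t" \<beta> i p i] \<open>0 \<le> t\<close>
    by (simp add: rad)
  have U: "?S \<union> ?T \<subseteq> ?U"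
    using bball_subset_bball[OF V(2,1), of i "rad i \<beta>"] bball_mono[OF rad_mono, of \<beta> "\<beta> + t" i p i] \<open>0 \<le> t\<close>
    by (simp add: rad commute)
  \<comment> \<open>Since \<open>t \<le> \<beta>\<close>, the inner radius is nonnegative; hence the
    counts are positive and the logarithms below are genuine.\<close>
  have center: "p \<in> ?W" using assms by (intro center_in_bball rad_nonneg) auto
  then have ne: "?S \<noteq> {}" "?T \<noteq> {}" using W by auto
  have pos: "0 < card ?W" using center finite_bball by (auto simp: card_gt_0_iff)
  have le: "card ?W \<le> card (?S \<inter> ?T)" "card (?S \<union> ?T) \<le> card ?U" "card (?S \<inter> ?T) \<le> card (?S \<union> ?T)"
    using W U finite_bball by (auto intro!: card_mono)
  have "\<pi>.iid.prob {\<pi> \<in> space \<pi>.iid. lbl (\<beta>, \<pi>) i p \<noteq> lbl (\<beta>, \<pi>) i q}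
      \<le> 1 - card (?S \<inter> ?T) / card (?S \<union> ?T)"
    unfolding lbl_eq using bball_subset_P ne by (intro \<pi>.prob_Min_neq_le)
  also have "\<dots> \<le> 1 - card ?W / card ?U"
    using le pos by (intro diff_left_mono frac_le) auto
  \<comment> \<open>The inequality \<open>1 - x \<le> - ln x\<close> turns the ratio into a
    difference of logarithms.\<close>
  also have "\<dots> \<le> - ln (card ?W / card ?U)"
    using ln_le_minus_one[of "card ?W / card ?U"] pos le by simp
  also have "\<dots> = ln_bball i p (\<beta> + t) - ln_bball i p (\<beta> - t)"
    using pos le by (simp add: ln_div ln_bball_def)
  finally show ?thesis .
qed

text \<open>The factor \<open>8 * t\<close> is the window \<open>2 * t\<close> times the density 4
  of \<open>\<beta>\<close>. As \<open>t\<close> is at most 1/8, the parameters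
  \<open>1/4 - t\<close> and \<open>1/2 + t\<close> stay between 1/8 and 5/8.\<close>

lemma prob_lbl_neq_le:
  assumes "p \<in> P" "q \<in> P" and t: "t = d p q * \<Gamma> / wt m i" "t \<le> 1/8"
  shows "measure (random_seed P) {\<omega> \<in> space (random_seed P). lbl \<omega> i p \<noteq> lbl \<omega> i q}
    \<le> 8 * t * (ln_bball i p (5/8) - ln_bball i p (1/8))"
proof -
  let ?U = "uniform_measure lborel {1/4..1/2 :: real}"
  let ?g = "ln_bball i p"
  define X where "X = {\<omega> \<in> space (random_seed P). lbl \<omega> i p \<noteq> lbl \<omega> i q}"
  have X: "X \<in> sets (?U \<Otimes>\<^sub>M \<pi>.iid)"
    unfolding X_def random_seed_eq[symmetric] by measurable
  have "0 \<le> t" using t wt_pos[of m i] \<Gamma>_ge_1 by simp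
  have meas: "(\<lambda>\<beta>. emeasure \<pi>.iid (Pair \<beta> -` X)) \<in> borel_measurable lborel"
    using \<pi>.iid.measurable_emeasure_Pair[OF X] by simp
  have sections: "emeasure \<pi>.iid (Pair \<beta> -` X) \<le> ennreal (?g (\<beta> + t) - ?g (\<beta> - t))"
    if "\<beta> \<in> {1/4..1/2}" for \<beta>
  proof -
    have "Pair \<beta> -` X = {\<pi> \<in> space \<pi>.iid. lbl (\<beta>, \<pi>) i p \<noteq> lbl (\<beta>, \<pi>) i q}"
      by (auto simp: X_def random_seed_eq space_pair_measure)
    then show ?thesis
      using prob_lbl_neq_given_le[OF assms(1,2) t(1), of \<beta>] that t(2)
      by (simp add: \<pi>.iid.emeasure_eq_measure ennreal_leI)
  qed
  have "emeasure (random_seed P) X = (\<integral>\<^sup>+ \<beta>. emeasure \<pi>.iid (Pair \<beta> -` X) \<partial>?U)"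
    unfolding random_seed_eq using X by (rule \<pi>.iid.emeasure_pair_measure_alt)
  also have "\<dots> = (\<integral>\<^sup>+ \<beta>. emeasure \<pi>.iid (Pair \<beta> -` X) * indicator {1/4..1/2} \<beta> \<partial>lborel)
      / emeasure lborel {1/4..1/2 :: real}"
    using meas by (intro nn_integral_uniform_measure) auto
  also have "\<dots> \<le> (\<integral>\<^sup>+ \<beta>. ennreal (?g (\<beta> + t) - ?g (\<beta> - t)) * indicator {1/4..1/2} \<beta> \<partial>lborel)
      / emeasure lborel {1/4..1/2 :: real}"
    using sections by (intro divide_right_mono_ennreal nn_integral_mono) (auto simp: indicator_def)
  also have "\<dots> \<le> ennreal (2 * t * (?g (1/2 + t) - ?g (1/4 - t))) / emeasure lborel {1/4..1/2 :: real}"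
    using \<open>0 \<le> t\<close> mono_ln_bball
    by (intro divide_right_mono_ennreal nn_integral_mono_increment_le) auto
  also have "\<dots> \<le> ennreal (2 * t * (?g (5/8) - ?g (1/8))) / emeasure lborel {1/4..1/2 :: real}"
    using \<open>0 \<le> t\<close> \<open>t \<le> 1/8\<close>
    by (intro divide_right_mono_ennreal ennreal_leI mult_left_mono diff_mono monoD[OF mono_ln_bball]) auto
  also have "\<dots> = ennreal (8 * t * (?g (5/8) - ?g (1/8)))"
    using \<open>0 \<le> t\<close> monoD[OF mono_ln_bball, of "1/8" "5/8" i p] by (simp add: divide_ennreal)
  finally show ?thesis
    using \<open>0 \<le> t\<close> monoD[OF mono_ln_bball, of "1/8" "5/8" i p]
    by (simp add: X_def[symmetric] measure_def enn2real_leI)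
qed

text \<open>Both bounding radii are values of the same sequence \<open>2 ^ j / 2 ^ K\<close>, with
  indices \<open>K + 1\<close> apart. The outer one holds as
  \<open>5/8 * w + w / 2 \<le> 2 * w\<close>, the inner one as \<open>w / (8 * \<Gamma>)\<close> is
  at least \<open>w / 2 ^ K\<close>.\<close>

lemma ln_bball_diff_le:
  assumes "i \<in> {1..m}" "8 * \<Gamma> \<le> 2 ^ K"
  shows "ln_bball i p (5/8) - ln_bball i p (1/8)
    \<le> ln_ball p (2 ^ (m - i + (K + 1)) / 2 ^ K) - ln_ball p (2 ^ (m - i) / 2 ^ K)"
proof (rule diff_mono)
  have "rad i (5/8) \<le> 5/8 * wt m i"
    using \<Gamma>_ge_1 wt_pos[of m i] by (simp add: divide_le_eq)
  then have "rad i (5/8) + wt m i / 2 \<le> 2 * wt m i" using wt_pos[of m i] by simp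
  also have "2 * wt m i = 2 ^ (m - i + (K + 1)) / 2 ^ K"
    by (simp add: wt_def power_add)
  finally have le: "rad i (5/8) + wt m i / 2 \<le> 2 ^ (m - i + (K + 1)) / 2 ^ K" .
  have "bball i p (rad i (5/8)) \<subseteq> mcball p (2 ^ (m - i + (K + 1)) / 2 ^ K) \<inter> P"
    using bball_dist_le[OF assms(1), of _ p "rad i (5/8)"] le bball_subset_P P_subset
    by (fastforce simp: mem_bball)
  then show "ln_bball i p (5/8) \<le> ln_ball p (2 ^ (m - i + (K + 1)) / 2 ^ K)"
    unfolding ln_bball_def ln_ball_def using finite_P by (intro ln_of_nat_mono card_mono) auto
  have "2 ^ (m - i) / 2 ^ K \<le> rad i (1/8)"
    using assms(2) \<Gamma>_ge_1 frac_le[of "wt m i" "wt m i" "8 * \<Gamma>" "2 ^ K"] wt_pos[of m i]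
    by (simp add: wt_def)
  then have "mcball p (2 ^ (m - i) / 2 ^ K) \<inter> P \<subseteq> bball i p (rad i (1/8))"
    using mcball_subset_bball mcball_subset_concentric by blast
  then show "ln_ball p (2 ^ (m - i) / 2 ^ K) \<le> ln_bball i p (1/8)"
    unfolding ln_bball_def ln_ball_def by (intro ln_of_nat_mono card_mono finite_bball)
qed

text \<open>The case split is at \<open>t = 1/8\<close>, that is
  \<open>w = 8 * d p q * \<Gamma>\<close>. Adding the bounds of both cases gives two sums over
  levels that are estimated separately.\<close>

lemma level_cost_le:
  assumes "p \<in> P" "q \<in> P" "i \<in> {1..m}" "8 * \<Gamma> \<le> 2 ^ K"
  defines "F \<equiv> \<lambda>j. ln_ball p (2 ^ j / 2 ^ K)"
  shows "4 * wt m i * measure (random_seed P) {\<omega> \<in> space (random_seed P). lbl \<omega> i p \<noteq> lbl \<omega> i q}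
    \<le> 32 * (d p q * \<Gamma>) * (F (m - i + (K + 1)) - F (m - i))
      + 4 * (if 2 ^ (m - i) < 8 * (d p q * \<Gamma>) then 2 ^ (m - i) else 0)"
    (is "4 * wt m i * ?prob \<le> _")
proof -
  have "F (m - i) \<le> F (m - i + (K + 1))"
    unfolding F_def by (intro monoD[OF mono_ln_ball] divide_right_mono power_increasing) auto
  then have F: "0 \<le> 32 * (d p q * \<Gamma>) * (F (m - i + (K + 1)) - F (m - i))"
    using \<Gamma>_ge_1 by simp
  show ?thesis
  proof (cases "wt m i < 8 * (d p q * \<Gamma>)")
    case True
    have "?prob \<le> 1" unfolding random_seed_eq by (rule seed.P.prob_le_1)
    then have "4 * wt m i * ?prob \<le> 4 * wt m i" using wt_pos[of m i] by simp
    also have "\<dots> = 4 * (if 2 ^ (m - i) < 8 * (d p q * \<Gamma>) then 2 ^ (m - i) else 0)"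
      using True by (simp add: wt_def)
    finally show ?thesis using F by linarith
  next
    case False
    let ?t = "d p q * \<Gamma> / wt m i"
    have "0 \<le> ?t" "?t \<le> 1/8" using False wt_pos[of m i] \<Gamma>_ge_1 by (simp_all add: field_simps)
    then have "?prob \<le> 8 * ?t * (ln_bball i p (5/8) - ln_bball i p (1/8))"
      using assms(1,2) by (intro prob_lbl_neq_le) auto
    also have "\<dots> \<le> 8 * ?t * (F (m - i + (K + 1)) - F (m - i))"
      unfolding F_def using \<open>0 \<le> ?t\<close> assms(3,4) by (intro mult_left_mono ln_bball_diff_le) auto
    finally have "4 * wt m i * ?prob \<le> 4 * wt m i * (8 * ?t * (F (m - i + (K + 1)) - F (m - i)))"
      using wt_pos[of m i] by (intro mult_left_mono) auto
    also have "\<dots> = 32 * (d p q * \<Gamma>) * (F (m - i + (K + 1)) - F (m - i))"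
      using wt_pos[of m i] by (simp add: field_simps)
    finally show ?thesis using False by (simp add: wt_def)
  qed
qed

section \<open>Integrability and the bound on the expectation\<close>

lemma integrable_tree_dist:
  assumes "p \<in> P" "q \<in> P"
  shows "integrable (random_seed P) (\<lambda>\<omega>. tree_dist (lbl \<omega>) P m p q)"
proof -
  interpret prob_space "random_seed P"
    unfolding random_seed_eq by (rule seed.P.prob_space_axioms)
  have "norm (tree_dist (lbl \<omega>) P m p q) \<le> (\<Sum>i=1..m. 4 * wt m i)" for \<omega>
  proof -
    have "2 \<le> 4 * wt m i" for i
      using one_le_power[of "2 :: real" "m - i"] unfolding wt_def by linarith
    then show ?thesis
      unfolding tree_dist_eq_sum[OF assms] using wt_pos[of m]
      by (intro order.trans[OF norm_sum] sum_mono) (auto simp: less_imp_le)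
  qed
  then show ?thesis
    by (intro integrable_const_bound[OF AE_I2 measurable_tree_dist[OF assms]])
qed

theorem expectation_tree_dist_le:
  assumes "p \<in> P" "q \<in> P"
  shows "(\<integral>\<omega>. tree_dist (lbl \<omega>) P m p q \<partial>random_seed P)
    \<le> 256 * (\<Gamma> * max 1 (log 2 \<Gamma>)) * log 2 (card P) * d p q"
proof (cases "p = q")
  \<comment> \<open>Both sides are 0. The other case has \<open>2 \<le> card P\<close>, so that
    \<open>log 2 (card P)\<close> is at least 1.\<close>
  case True
  have "tree_dist (lbl \<omega>) P m p q = 0" for \<omega>
    using True assms by (intro tree_dist_0) auto
  then show ?thesis using True assms P_subset by auto
next
  case False
  interpret prob_space "random_seed P"
    unfolding random_seed_eq by (rule seed.P.prob_space_axioms)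
  define K where "K = nat \<lceil>log 2 (8 * \<Gamma>)\<rceil>"
  define L where "L = max 1 (log 2 \<Gamma>)"
  define D where "D = d p q * \<Gamma>"
  let ?N = "log 2 (card P)"
  let ?F = "\<lambda>j. ln_ball p (2 ^ j / 2 ^ K)"
  let ?X = "\<lambda>i. {\<omega> \<in> space (random_seed P). lbl \<omega> i p \<noteq> lbl \<omega> i q}"
  have "0 \<le> D" using \<Gamma>_ge_1 by (simp add: D_def)
  have log8: "log 2 (8 * \<Gamma>) = 3 + log 2 \<Gamma>"
    using \<Gamma>_ge_1 log_pow_cancel[of 2 3] by (simp add: log_mult)
  have "0 \<le> log 2 \<Gamma>" using \<Gamma>_ge_1 by simp
  have "8 * \<Gamma> = 2 powr log 2 (8 * \<Gamma>)" using \<Gamma>_ge_1 by simp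
  also have "\<dots> \<le> 2 powr K" by (intro powr_mono) (auto simp: K_def intro: real_nat_ceiling_ge)
  also have "\<dots> = 2 ^ K" by (simp add: powr_realpow)
  finally have K: "8 * \<Gamma> \<le> 2 ^ K" .
  \<comment> \<open>Rounding up gives \<open>K + 1 \<le> 5 + log 2 \<Gamma>\<close>, and both terms
    are bounded through \<open>L\<close>, which is at least 1.\<close>
  have KL: "real (K + 1) \<le> 6 * L"
    using log8 \<open>0 \<le> log 2 \<Gamma>\<close> by (simp add: K_def L_def) linarith
  have "card {p, q} \<le> card P" using assms finite_P by (intro card_mono) auto
  then have n: "2 \<le> card P" using False by simp
  have N: "1 \<le> ?N" using n by (simp add: le_log_iff)
  have lnN: "ln (card P) \<le> ?N"
    using n ln_2_less_1 by (simp add: log_def field_simps mult_left_le)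
  have X: "?X i \<in> events" for i by measurable
  have "(\<integral>\<omega>. tree_dist (lbl \<omega>) P m p q \<partial>random_seed P)
      \<le> (\<integral>\<omega>. (\<Sum>i=1..m. 4 * wt m i * indicator (?X i) \<omega>) \<partial>random_seed P)"
  proof (intro integral_mono integrable_tree_dist assms)
    show "integrable (random_seed P) (\<lambda>\<omega>. \<Sum>i=1..m. 4 * wt m i * indicator (?X i) \<omega>)"
      using X by (intro Bochner_Integration.integrable_sum integrable_mult_right)
        (simp add: integrable_indicator_iff less_top[symmetric])
    fix \<omega> assume "\<omega> \<in> space (random_seed P)"
    then have "(\<Sum>i=1..m. 4 * wt m i * indicator (?X i) \<omega>)
        = (\<Sum>i=1..m. if lbl \<omega> i p \<noteq> lbl \<omega> i q then 4 * wt m i else 0)"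
      by (intro sum.cong) (auto simp: indicator_def)
    then show "tree_dist (lbl \<omega>) P m p q \<le> (\<Sum>i=1..m. 4 * wt m i * indicator (?X i) \<omega>)"
      using tree_dist_le[OF assms, of "lbl \<omega>" m] by simp
  qed
  also have "\<dots> = (\<Sum>i=1..m. 4 * wt m i * prob (?X i))"
    using X by (subst Bochner_Integration.integral_sum)
      (auto intro!: integrable_mult_right simp: integrable_indicator_iff less_top[symmetric])
  also have "\<dots> \<le> (\<Sum>i=1..m. 32 * D * (?F (m - i + (K + 1)) - ?F (m - i))
      + 4 * (if 2 ^ (m - i) < 8 * D then 2 ^ (m - i) else 0))"
    unfolding D_def using assms K by (intro sum_mono level_cost_le)
  \<comment> \<open>With \<open>j = m - i\<close> the levels run over the exponents of the powers of
    two.\<close>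
  also have "\<dots> = (\<Sum>j<m. 32 * D * (?F (j + (K + 1)) - ?F j) + 4 * (if 2 ^ j < 8 * D then 2 ^ j else 0))"
    by (rule sum.reindex_bij_witness[of _ "\<lambda>j. m - j" "\<lambda>i. m - i"]) auto
  also have "\<dots> = 32 * D * (\<Sum>j<m. ?F (j + (K + 1)) - ?F j) + 4 * (\<Sum>j<m. if 2 ^ j < 8 * D then 2 ^ j else 0)"
    by (simp only: sum.distrib sum_distrib_left)
  also have "\<dots> \<le> 32 * D * (real (K + 1) * ln (card P)) + 4 * (2 * (8 * D))"
    using \<open>0 \<le> D\<close> ln_ball_bounds
    by (intro add_mono mult_left_mono sum_shift_diff_le sum_small_powers_le) auto
  also have "\<dots> \<le> 32 * D * (6 * L * ?N) + 64 * D * (L * ?N)"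
  proof (intro add_mono)
    show "32 * D * (real (K + 1) * ln (card P)) \<le> 32 * D * (6 * L * ?N)"
      using KL lnN \<open>0 \<le> D\<close> n by (intro mult_left_mono mult_mono) auto
    \<comment> \<open>This lets the geometric part, \<open>64 * D\<close>, be absorbed; the final
      constant is \<open>32 * 6 + 64 = 256\<close>.\<close>
    have "1 * 1 \<le> L * ?N" using N by (intro mult_mono) (auto simp: L_def)
    then show "4 * (2 * (8 * D)) \<le> 64 * D * (L * ?N)"
      using mult_left_mono[of 1 "L * ?N" "64 * D"] \<open>0 \<le> D\<close> by simp
  qed
  also have "\<dots> = 256 * (\<Gamma> * max 1 (log 2 \<Gamma>)) * ?N * d p q"
    by (simp add: D_def L_def)
  finally show ?thesis .
qed

end

text \<open>\<open>max 1 (log 2 \<Gamma>)\<close> replaces the logarithm because the latter vanishes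
  at \<open>\<Gamma> = 1\<close>. Integrability is asserted too, since the Bochner integral of a
  non-integrable function is 0. Domination is almost sure, with tied values of \<open>\<pi>\<close>
  excluded, and \<open>C\<close> is uniform in all data.\<close>

theorem lemma3p1:
  "\<exists>C>0. \<forall>(V :: 'v set) (d :: 'v \<Rightarrow> 'v \<Rightarrow> real) (P :: 'v set) (n :: nat) (m :: nat)
      (\<Gamma> :: real) (\<phi> :: nat \<Rightarrow> 'v \<Rightarrow> 'u).
    Metric_space V d \<longrightarrow>
    P \<subseteq> V \<longrightarrow> finite P \<longrightarrow> card P = n \<longrightarrow>
    (\<forall>p\<in>P. \<forall>q\<in>P. p \<noteq> q \<longrightarrow> 1 < d p q) \<longrightarrow>
    1 \<le> m \<longrightarrow> diam d P = 2 ^ (m - 1) \<longrightarrow>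
    1 \<le> \<Gamma> \<longrightarrow>
    (\<forall>i\<in>{1..m}. \<forall>z\<in>\<phi> i ` V. diam d {x \<in> V. \<phi> i x = z} \<le> ennreal (wt m i / 2)) \<longrightarrow>
    (2 \<le> \<Gamma> \<longrightarrow>
      (AE \<omega> in random_seed P. \<forall>p\<in>P. \<forall>q\<in>P. d p q \<le> tree_dist (label V d P m \<Gamma> \<phi> \<omega>) P m p q)) \<and>
    (\<forall>p\<in>P. \<forall>q\<in>P.
      integrable (random_seed P) (\<lambda>\<omega>. tree_dist (label V d P m \<Gamma> \<phi> \<omega>) P m p q) \<and>
      (\<integral>\<omega>. tree_dist (label V d P m \<Gamma> \<phi> \<omega>) P m p q \<partial>random_seed P)
        \<le> C * (\<Gamma> * max 1 (log 2 \<Gamma>)) * log 2 (real n) * d p q)"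
proof (intro exI[of _ 256] conjI allI impI)
  show "(0 :: real) < 256" by simp
next
  fix V P :: "'v set" and d :: "'v \<Rightarrow> 'v \<Rightarrow> real" and n m :: nat and \<Gamma> :: real
    and \<phi> :: "nat \<Rightarrow> 'v \<Rightarrow> 'u"
  assume "Metric_space V d" "P \<subseteq> V" "finite P" and n: "card P = n"
    and sep: "\<forall>p\<in>P. \<forall>q\<in>P. p \<noteq> q \<longrightarrow> 1 < d p q"
    and "1 \<le> m" and diam: "diam d P = 2 ^ (m - 1)" and "1 \<le> \<Gamma>"
    and buckets: "\<forall>i\<in>{1..m}. \<forall>z\<in>\<phi> i ` V. diam d {x \<in> V. \<phi> i x = z} \<le> ennreal (wt m i / 2)"
  interpret bucketing V d P m \<Gamma> \<phi>
  proof (rule bucketing.intro[OF \<open>Metric_space V d\<close>], unfold_locales)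
    fix i x y assume *: "i \<in> {1..m}" "x \<in> V" "y \<in> V" "\<phi> i x = \<phi> i y"
    then have "ennreal (d x y) \<le> diam d {u \<in> V. \<phi> i u = \<phi> i x}"
      by (intro dist_le_diam) auto
    also have "\<dots> \<le> ennreal (wt m i / 2)" using buckets * by auto
    finally show "d x y \<le> wt m i / 2" using wt_pos[of m i] by (simp add: ennreal_le_iff)
  qed fact+
  show "AE \<omega> in random_seed P. \<forall>p\<in>P. \<forall>q\<in>P. d p q \<le> tree_dist (label V d P m \<Gamma> \<phi> \<omega>) P m p q"
    if "2 \<le> \<Gamma>"
    using AE_random_seed
  proof eventually_elim
    fix \<omega> :: "real \<times> ('v \<Rightarrow> real)" assume \<omega>: "fst \<omega> \<in> {1/4..1/2} \<and> inj_on (snd \<omega>) P"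
    have "d p q \<le> 2 ^ (m - 1)" if "p \<in> P" "q \<in> P" for p q
    proof -
      have "ennreal (d p q) \<le> ennreal (2 ^ (m - 1))"
        using dist_le_diam[OF that, of d] diam by (simp add: ennreal_power[symmetric])
      then show ?thesis by (simp add: ennreal_le_iff)
    qed
    then show "\<forall>p\<in>P. \<forall>q\<in>P. d p q \<le> tree_dist (label V d P m \<Gamma> \<phi> \<omega>) P m p q"
      using tree_dist_dominates[of "snd \<omega>" "fst \<omega>"] sep \<open>1 \<le> m\<close> \<open>2 \<le> \<Gamma>\<close> \<omega> by auto
  qed
  show "\<forall>p\<in>P. \<forall>q\<in>P. integrable (random_seed P) (\<lambda>\<omega>. tree_dist (label V d P m \<Gamma> \<phi> \<omega>) P m p q) \<and>
      (\<integral>\<omega>. tree_dist (label V d P m \<Gamma> \<phi> \<omega>) P m p q \<partial>random_seed P)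
        \<le> 256 * (\<Gamma> * max 1 (log 2 \<Gamma>)) * log 2 (real n) * d p q"
    using integrable_tree_dist expectation_tree_dist_le n by auto
qed

end
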